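(* Let $\mathbf{k}$ be a commutative unital ring, $n\ge 1$, and $\lambda\in\mathbf{k}\setminus\{0\}$. Let $\mathfrak{m}$ be matrix multiplication, $E$ the identity matrix, and define $$\Delta_\lambda:M_n(\mathbf{k})\to M_n(\mathbf{k})\otimes M_n(\mathbf{k}),\qquad \Delta_\lambda(M)=M\otimes(-\lambda E).$$ Then $(M_n(\mathbf{k}),\mathfrak{m},E,\Delta_\lambda)$ is an infinitesimal unitary bialgebra of weight $\lambda$.
   Context: Tensor products are over $\mathbf{k}$. For an associative algebra $A$, $A\otimes A$ is an $A$-bimodule via $a\cdot(b\otimes c)=ab\otimes c$ and $(b\otimes c)\cdot a=b\otimes ca$. For $\lambda\in\mathbf{k}$, an infinitesimal unitary bialgebra of weight $\lambda$ is a quadruple $(A,m,1,\Delta)$ where $(A,m,1)$ is a unital associative $\mathbf{k}$-algebra and $\Delta:A\to A\otimes A$ is a coassociative linear map (no counit is required) such that $\Delta(ab)=a\cdot\Delta(b)+\Delta(a)\cdot b+\lambda(a\otimes b)$ for all $a,b\in A$. *)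

theory Defs
  imports "HOL-Algebra.AbelCoset" "Jordan_Normal_Form.VS_Connect"
begin

section \<open>Tensor products of modules over a commutative ring\<close>

text \<open>
  The record type of modules extends that of rings; the fields \<open>mult\<close> and \<open>one\<close> play no role
  for the modules built here and are left unspecified.
\<close>

definition free_module :: "('r, 'c) ring_scheme \<Rightarrow> 'x set \<Rightarrow> ('r, 'x \<Rightarrow> 'r) module" where
  "free_module R X =
    \<lparr>carrier = {f. range f \<subseteq> carrier R \<and> (\<forall>x. x \<notin> X \<longrightarrow> f x = \<zero>\<^bsub>R\<^esub>) \<and> finite {x. f x \<noteq> \<zero>\<^bsub>R\<^esub>}},
     mult = undefined, one = undefined,
     zero = (\<lambda>x. \<zero>\<^bsub>R\<^esub>), add = (\<lambda>f g x. f x \<oplus>\<^bsub>R\<^esub> g x),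
     smult = (\<lambda>a f x. a \<otimes>\<^bsub>R\<^esub> f x)\<rparr>"

definition free_gen :: "('r, 'c) ring_scheme \<Rightarrow> 'x \<Rightarrow> 'x \<Rightarrow> 'r" where
  "free_gen R x = (\<lambda>y. if y = x then \<one>\<^bsub>R\<^esub> else \<zero>\<^bsub>R\<^esub>)"

definition quotient_module :: "('r, 'm, 'd) module_scheme \<Rightarrow> 'm set \<Rightarrow> ('r, 'm set) module" where
  "quotient_module M N =
    \<lparr>carrier = a_rcosets\<^bsub>M\<^esub> N,
     mult = undefined, one = undefined,
     zero = N, add = set_add M,
     smult = (\<lambda>a C. \<Union>x\<in>C. N +>\<^bsub>M\<^esub> (a \<odot>\<^bsub>M\<^esub> x))\<rparr>"

text \<open>The differences that must vanish for \<open>(x, y) \<mapsto> x \<otimes> y\<close> to be bilinear.\<close>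

definition bilinearity_relators ::
  "('r, 'c) ring_scheme \<Rightarrow> ('r, 'm, 'd) module_scheme \<Rightarrow> ('r, 'n, 'e) module_scheme
    \<Rightarrow> ('m \<times> 'n \<Rightarrow> 'r) set" where
  "bilinearity_relators R M N =
    (let F = free_module R (carrier M \<times> carrier N); g = (\<lambda>x y. free_gen R (x, y)) in
      {g (x \<oplus>\<^bsub>M\<^esub> x') y \<ominus>\<^bsub>F\<^esub> (g x y \<oplus>\<^bsub>F\<^esub> g x' y) | x x' y.
         x \<in> carrier M \<and> x' \<in> carrier M \<and> y \<in> carrier N}
    \<union> {g x (y \<oplus>\<^bsub>N\<^esub> y') \<ominus>\<^bsub>F\<^esub> (g x y \<oplus>\<^bsub>F\<^esub> g x y') | x y y'.
         x \<in> carrier M \<and> y \<in> carrier N \<and> y' \<in> carrier N}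
    \<union> {g (a \<odot>\<^bsub>M\<^esub> x) y \<ominus>\<^bsub>F\<^esub> a \<odot>\<^bsub>F\<^esub> g x y | a x y.
         a \<in> carrier R \<and> x \<in> carrier M \<and> y \<in> carrier N}
    \<union> {g x (a \<odot>\<^bsub>N\<^esub> y) \<ominus>\<^bsub>F\<^esub> a \<odot>\<^bsub>F\<^esub> g x y | a x y.
         a \<in> carrier R \<and> x \<in> carrier M \<and> y \<in> carrier N})"

definition tensor_relations ::
  "('r, 'c) ring_scheme \<Rightarrow> ('r, 'm, 'd) module_scheme \<Rightarrow> ('r, 'n, 'e) module_scheme
    \<Rightarrow> ('m \<times> 'n \<Rightarrow> 'r) set" where
  "tensor_relations R M N =
    LinearCombinations.module.span R (free_module R (carrier M \<times> carrier N))
      (bilinearity_relators R M N)"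

definition tensor_product ::
  "('r, 'c) ring_scheme \<Rightarrow> ('r, 'm, 'd) module_scheme \<Rightarrow> ('r, 'n, 'e) module_scheme
    \<Rightarrow> ('r, ('m \<times> 'n \<Rightarrow> 'r) set) module" where
  "tensor_product R M N =
    quotient_module (free_module R (carrier M \<times> carrier N)) (tensor_relations R M N)"

definition pure_tensor ::
  "('r, 'c) ring_scheme \<Rightarrow> ('r, 'm, 'd) module_scheme \<Rightarrow> ('r, 'n, 'e) module_scheme
    \<Rightarrow> 'm \<Rightarrow> 'n \<Rightarrow> ('m \<times> 'n \<Rightarrow> 'r) set" where
  "pure_tensor R M N x y =
    tensor_relations R M N +>\<^bsub>free_module R (carrier M \<times> carrier N)\<^esub> free_gen R (x, y)"

text \<open>
  The linear map out of a tensor product induced by a bilinear map \<open>\<beta>\<close> with values in \<open>P\<close>: every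
  representative \<open>\<Sum> f (x, y) (x, y)\<close> of a class has the same value \<open>\<Sum> f (x, y) \<beta> x y\<close>. It is
  meaningful for bilinear \<open>\<beta>\<close> only.
\<close>

definition tensor_lift ::
  "('r, 'c) ring_scheme \<Rightarrow> ('r, 'p, 'd) module_scheme \<Rightarrow> ('m \<Rightarrow> 'n \<Rightarrow> 'p)
    \<Rightarrow> ('m \<times> 'n \<Rightarrow> 'r) set \<Rightarrow> 'p" where
  "tensor_lift R P \<beta> t =
    the_elem ((\<lambda>f. \<Oplus>\<^bsub>P\<^esub>p \<in> {p. f p \<noteq> \<zero>\<^bsub>R\<^esub>}. f p \<odot>\<^bsub>P\<^esub> \<beta> (fst p) (snd p)) ` t)"

text \<open>\<open>f \<otimes> g\<close> with values in \<open>M' \<otimes> N'\<close>.\<close>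

definition tensor_map ::
  "('r, 'c) ring_scheme \<Rightarrow> ('r, 'm', 'd) module_scheme \<Rightarrow> ('r, 'n', 'e) module_scheme
    \<Rightarrow> ('m \<Rightarrow> 'm') \<Rightarrow> ('n \<Rightarrow> 'n')
    \<Rightarrow> ('m \<times> 'n \<Rightarrow> 'r) set \<Rightarrow> ('m' \<times> 'n' \<Rightarrow> 'r) set" where
  "tensor_map R M' N' f g =
    tensor_lift R (tensor_product R M' N') (\<lambda>x y. pure_tensor R M' N' (f x) (g y))"

text \<open>The canonical map \<open>(L \<otimes> M) \<otimes> N \<rightarrow> L \<otimes> (M \<otimes> N)\<close>, \<open>(x \<otimes> y) \<otimes> z \<mapsto> x \<otimes> (y \<otimes> z)\<close>.\<close>

definition tensor_assoc ::
  "('r, 'c) ring_scheme \<Rightarrow> ('r, 'l, 'b) module_scheme \<Rightarrow> ('r, 'm, 'd) module_scheme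
    \<Rightarrow> ('r, 'n, 'e) module_scheme
    \<Rightarrow> (('l \<times> 'm \<Rightarrow> 'r) set \<times> 'n \<Rightarrow> 'r) set \<Rightarrow> ('l \<times> ('m \<times> 'n \<Rightarrow> 'r) set \<Rightarrow> 'r) set" where
  "tensor_assoc R L M N =
    (let MN = tensor_product R M N; P = tensor_product R L MN in
      tensor_lift R P (\<lambda>t z. tensor_lift R P (\<lambda>x y. pure_tensor R L MN x (pure_tensor R M N y z)) t))"


section \<open>Infinitesimal unitary bialgebras\<close>

text \<open>The locale \<open>algebra\<close> of HOL-Algebra is restricted to commutative algebras.\<close>

locale assoc_algebra = Module.module R A + ring A for R and A (structure) +
  assumes smult_mult_left: "\<lbrakk>a \<in> carrier R; x \<in> carrier A; y \<in> carrier A\<rbrakk> \<Longrightarrow>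
      (a \<odot> x) \<otimes> y = a \<odot> (x \<otimes> y)"
    and smult_mult_right: "\<lbrakk>a \<in> carrier R; x \<in> carrier A; y \<in> carrier A\<rbrakk> \<Longrightarrow>
      x \<otimes> (a \<odot> y) = a \<odot> (x \<otimes> y)"

text \<open>\<open>a \<cdot> (b \<otimes> c) = a b \<otimes> c\<close> and \<open>(b \<otimes> c) \<cdot> a = b \<otimes> c a\<close>.\<close>

definition tensor_left_action ::
  "('r, 'c) ring_scheme \<Rightarrow> ('r, 'a, 'd) module_scheme \<Rightarrow> 'a
    \<Rightarrow> ('a \<times> 'a \<Rightarrow> 'r) set \<Rightarrow> ('a \<times> 'a \<Rightarrow> 'r) set" where
  "tensor_left_action R A a = tensor_map R A A (\<lambda>b. a \<otimes>\<^bsub>A\<^esub> b) id"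

definition tensor_right_action ::
  "('r, 'c) ring_scheme \<Rightarrow> ('r, 'a, 'd) module_scheme
    \<Rightarrow> ('a \<times> 'a \<Rightarrow> 'r) set \<Rightarrow> 'a \<Rightarrow> ('a \<times> 'a \<Rightarrow> 'r) set" where
  "tensor_right_action R A t a = tensor_map R A A id (\<lambda>c. c \<otimes>\<^bsub>A\<^esub> a) t"

locale infinitesimal_unitary_bialgebra = assoc_algebra R A for R and A (structure) +
  fixes weight :: 'a
    and \<Delta> :: "'c \<Rightarrow> ('c \<times> 'c \<Rightarrow> 'a) set"
  assumes weight_closed: "weight \<in> carrier R"
    and coproduct_linear: "\<Delta> \<in> LinearCombinations.module_hom R A (tensor_product R A A)"
    and coassociative: "x \<in> carrier A \<Longrightarrow>
      tensor_assoc R A A A (tensor_map R (tensor_product R A A) A \<Delta> id (\<Delta> x))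
        = tensor_map R A (tensor_product R A A) id \<Delta> (\<Delta> x)"
    and coproduct_mult: "\<lbrakk>x \<in> carrier A; y \<in> carrier A\<rbrakk> \<Longrightarrow>
      \<Delta> (x \<otimes> y)
        = tensor_left_action R A x (\<Delta> y) \<oplus>\<^bsub>tensor_product R A A\<^esub> tensor_right_action R A (\<Delta> x) y
          \<oplus>\<^bsub>tensor_product R A A\<^esub> weight \<odot>\<^bsub>tensor_product R A A\<^esub> pure_tensor R A A x y"

end

theory Submission
  imports Defs
begin

text \<open>
  In any associative unital algebra, \<open>\<Delta> x = x \<otimes> e\<close> with \<open>e = - \<lambda> \<cdot> 1\<close> is linear and sends both sides
  of coassociativity to \<open>x \<otimes> (e \<otimes> e)\<close>. Moreover \<open>x \<cdot> \<Delta> y = x y \<otimes> e = \<Delta> (x y)\<close>, while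
  \<open>\<Delta> x \<cdot> y = x \<otimes> e y = - \<lambda> (x \<otimes> y)\<close> cancels the weight term. What takes work is the universal
  property of the tensor product, which evaluates the maps of the definition on pure tensors; the
  associator needs in addition that lifting a linear family of bilinear maps is again linear.
\<close>

section \<open>Free modules of finitely supported functions\<close>

lemma free_module_simps:
  "carrier (free_module R X) =
    {f. range f \<subseteq> carrier R \<and> (\<forall>x. x \<notin> X \<longrightarrow> f x = \<zero>\<^bsub>R\<^esub>) \<and> finite {x. f x \<noteq> \<zero>\<^bsub>R\<^esub>}}"
  "zero (free_module R X) = (\<lambda>x. \<zero>\<^bsub>R\<^esub>)"
  "add (free_module R X) = (\<lambda>f g x. f x \<oplus>\<^bsub>R\<^esub> g x)"
  "smult (free_module R X) = (\<lambda>a f x. a \<otimes>\<^bsub>R\<^esub> f x)"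
  by (simp_all add: free_module_def)

lemma free_module_carrierD:
  assumes "f \<in> carrier (free_module R X)"
  shows "f x \<in> carrier R" "finite {x. f x \<noteq> \<zero>\<^bsub>R\<^esub>}" "{x. f x \<noteq> \<zero>\<^bsub>R\<^esub>} \<subseteq> X"
  using assms by (auto simp: free_module_simps)

lemma (in cring) free_module_closed:
  assumes "f \<in> carrier (free_module R X)"
  shows "g \<in> carrier (free_module R X) \<Longrightarrow> f \<oplus>\<^bsub>free_module R X\<^esub> g \<in> carrier (free_module R X)"
    and "a \<in> carrier R \<Longrightarrow> a \<odot>\<^bsub>free_module R X\<^esub> f \<in> carrier (free_module R X)"
proof -
  have "finite {x. f x \<oplus> g x \<noteq> \<zero>}" if "g \<in> carrier (free_module R X)"
    by (rule finite_subset[of _ "{x. f x \<noteq> \<zero>} \<union> {x. g x \<noteq> \<zero>}"])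
      (use assms that in \<open>auto simp: free_module_simps\<close>)
  then show "f \<oplus>\<^bsub>free_module R X\<^esub> g \<in> carrier (free_module R X)"
    if "g \<in> carrier (free_module R X)"
    using assms that by (auto simp: free_module_simps image_subset_iff)
  have "finite {x. a \<otimes> f x \<noteq> \<zero>}" if "a \<in> carrier R"
    by (rule finite_subset[of _ "{x. f x \<noteq> \<zero>}"])
      (use assms that in \<open>auto simp: free_module_simps\<close>)
  then show "a \<odot>\<^bsub>free_module R X\<^esub> f \<in> carrier (free_module R X)" if "a \<in> carrier R"
    using assms that by (auto simp: free_module_simps image_subset_iff)
qed

lemma (in cring) free_module_module: "Module.module R (free_module R X)"
proof (rule Module.moduleI)
  let ?F = "free_module R X"
  \<comment> \<open>Values lie in \<open>R\<close> at every point, also outside \<open>X\<close>, so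
    each module law follows pointwise from the corresponding ring law.\<close>
  have val: "f x \<in> carrier R" if "f \<in> carrier ?F" for f x
    by (rule free_module_carrierD(1)[OF that])
  note ops = free_module_simps(2-4)
  show "cring R" by (rule is_cring)
  show "abelian_group ?F"
  proof (rule abelian_groupI)
    show "\<zero>\<^bsub>?F\<^esub> \<in> carrier ?F" by (auto simp: free_module_simps)
    fix f assume f: "f \<in> carrier ?F"
    \<comment> \<open>The negative is taken as a scalar multiple by -1, so its membership follows
      from the closure already shown.\<close>
    show "\<exists>g\<in>carrier ?F. g \<oplus>\<^bsub>?F\<^esub> f = \<zero>\<^bsub>?F\<^esub>"
      using f by (intro bexI[of _ "\<ominus> \<one> \<odot>\<^bsub>?F\<^esub> f"] free_module_closed)
        (auto simp: ops val l_minus l_neg)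
    show "\<zero>\<^bsub>?F\<^esub> \<oplus>\<^bsub>?F\<^esub> f = f" using f by (simp add: ops val)
    fix g assume g: "g \<in> carrier ?F"
    show "f \<oplus>\<^bsub>?F\<^esub> g \<in> carrier ?F" by (rule free_module_closed(1)[OF f g])
    show "f \<oplus>\<^bsub>?F\<^esub> g = g \<oplus>\<^bsub>?F\<^esub> f" using f g by (simp add: ops val a_comm)
    fix h assume h: "h \<in> carrier ?F"
    show "(f \<oplus>\<^bsub>?F\<^esub> g) \<oplus>\<^bsub>?F\<^esub> h = f \<oplus>\<^bsub>?F\<^esub> (g \<oplus>\<^bsub>?F\<^esub> h)"
      using f g h by (simp add: ops val a_assoc)
  qed
  fix f assume f: "f \<in> carrier ?F"
  show "\<one> \<odot>\<^bsub>?F\<^esub> f = f" using f by (simp add: ops val)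
  fix a assume a: "a \<in> carrier R"
  show "a \<odot>\<^bsub>?F\<^esub> f \<in> carrier ?F" by (rule free_module_closed(2)[OF f a])
  show "a \<odot>\<^bsub>?F\<^esub> (f \<oplus>\<^bsub>?F\<^esub> g) = a \<odot>\<^bsub>?F\<^esub> f \<oplus>\<^bsub>?F\<^esub> a \<odot>\<^bsub>?F\<^esub> g" if "g \<in> carrier ?F" for g
    using a f that by (simp add: ops val r_distr)
  fix b assume b: "b \<in> carrier R"
  show "(a \<oplus> b) \<odot>\<^bsub>?F\<^esub> f = a \<odot>\<^bsub>?F\<^esub> f \<oplus>\<^bsub>?F\<^esub> b \<odot>\<^bsub>?F\<^esub> f"
    using a b f by (simp add: ops val l_distr)
  show "(a \<otimes> b) \<odot>\<^bsub>?F\<^esub> f = a \<odot>\<^bsub>?F\<^esub> (b \<odot>\<^bsub>?F\<^esub> f)"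
    using a b f by (simp add: ops val m_assoc)
qed

lemma (in cring) free_gen_closed:
  "x \<in> X \<Longrightarrow> free_gen R x \<in> carrier (free_module R X)"
  by (auto simp: free_module_simps free_gen_def)

section \<open>Quotients of modules by submodules\<close>

lemma submodule_abelian_subgroup:
  assumes "LinearCombinations.submodule R N M"
  shows "abelian_subgroup N M"
proof -
  interpret N: LinearCombinations.submodule R N M by fact
  interpret M: Module.module R M by (rule N.module)
  \<comment> \<open>Submodules are given by closure under sums and scalars; negation is scaling by
    -1.\<close>
  have "\<ominus>\<^bsub>M\<^esub> x \<in> N" if "x \<in> N" for x
    using that N.subset N.smult_closed[of "\<ominus>\<^bsub>R\<^esub> \<one>\<^bsub>R\<^esub>" x] M.smult_minus_1[of x]
    by (metis M.R.add.inv_closed M.R.one_closed subsetD)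
  then have "subgroup N (add_monoid M)"
    using N.subset by (intro M.add.subgroupI) (auto simp flip: a_inv_def intro: N.zero_closed)
  then show ?thesis
    by (intro abelian_subgroupI3 additive_subgroupI M.abelian_group_axioms)
qed

text \<open>Zero is rewritten as a coset of \<open>\<zero>\<close> so that all the structure is
  expressed on representatives; the module laws of the quotient then reduce to those of
  \<open>M\<close>.\<close>

lemma quotient_module_simps:
  assumes "LinearCombinations.submodule R N M"
  shows "carrier (quotient_module M N) = (\<lambda>x. N +>\<^bsub>M\<^esub> x) ` carrier M"
    and "zero (quotient_module M N) = N +>\<^bsub>M\<^esub> \<zero>\<^bsub>M\<^esub>"
    and "\<And>x y. \<lbrakk>x \<in> carrier M; y \<in> carrier M\<rbrakk> \<Longrightarrow>
      (N +>\<^bsub>M\<^esub> x) \<oplus>\<^bsub>quotient_module M N\<^esub> (N +>\<^bsub>M\<^esub> y) = N +>\<^bsub>M\<^esub> (x \<oplus>\<^bsub>M\<^esub> y)"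
    and "\<And>a x. \<lbrakk>a \<in> carrier R; x \<in> carrier M\<rbrakk> \<Longrightarrow>
      a \<odot>\<^bsub>quotient_module M N\<^esub> (N +>\<^bsub>M\<^esub> x) = N +>\<^bsub>M\<^esub> (a \<odot>\<^bsub>M\<^esub> x)"
proof -
  interpret N: LinearCombinations.submodule R N M by fact
  interpret M: Module.module R M by (rule N.module)
  interpret S: abelian_subgroup N M by (rule submodule_abelian_subgroup) fact
  show "carrier (quotient_module M N) = (\<lambda>x. N +>\<^bsub>M\<^esub> x) ` carrier M"
    by (auto simp: quotient_module_def A_RCOSETS_def RCOSETS_def a_r_coset_def)
  show "zero (quotient_module M N) = N +>\<^bsub>M\<^esub> \<zero>\<^bsub>M\<^esub>"
    using N.subset by (simp add: quotient_module_def)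
  show "(N +>\<^bsub>M\<^esub> x) \<oplus>\<^bsub>quotient_module M N\<^esub> (N +>\<^bsub>M\<^esub> y) = N +>\<^bsub>M\<^esub> (x \<oplus>\<^bsub>M\<^esub> y)"
    if "x \<in> carrier M" "y \<in> carrier M" for x y
    using that by (simp add: quotient_module_def S.a_rcos_sum)
  show "a \<odot>\<^bsub>quotient_module M N\<^esub> (N +>\<^bsub>M\<^esub> x) = N +>\<^bsub>M\<^esub> (a \<odot>\<^bsub>M\<^esub> x)"
    if a: "a \<in> carrier R" and x: "x \<in> carrier M" for a x
  proof -
    \<comment> \<open>Scalar multiplication was defined as a union over representatives. All its
      members agree: if y = h + x with h in \<open>N\<close>, then a y and a x differ by a h, which
      lies in \<open>N\<close>.\<close>
    have coset_eq: "N +>\<^bsub>M\<^esub> (a \<odot>\<^bsub>M\<^esub> y) = N +>\<^bsub>M\<^esub> (a \<odot>\<^bsub>M\<^esub> x)" if "y \<in> N +>\<^bsub>M\<^esub> x" for y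
    proof -
      from that obtain h where h: "h \<in> N" "y = h \<oplus>\<^bsub>M\<^esub> x"
        by (auto simp: a_r_coset_def')
      with a x N.subset have "a \<odot>\<^bsub>M\<^esub> y = a \<odot>\<^bsub>M\<^esub> h \<oplus>\<^bsub>M\<^esub> a \<odot>\<^bsub>M\<^esub> x"
        by (auto intro: M.smult_r_distr)
      with a h(1) have "a \<odot>\<^bsub>M\<^esub> y \<in> N +>\<^bsub>M\<^esub> (a \<odot>\<^bsub>M\<^esub> x)"
        by (auto simp: a_r_coset_def')
      then show ?thesis
        using a x S.a_repr_independence'[of "a \<odot>\<^bsub>M\<^esub> y" "a \<odot>\<^bsub>M\<^esub> x"] by simp
    qed
    \<comment> \<open>A union of equal sets is that set only over a nonempty index; x itself lies in
      its coset.\<close>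
    have "(\<Union>y\<in>N +>\<^bsub>M\<^esub> x. N +>\<^bsub>M\<^esub> (a \<odot>\<^bsub>M\<^esub> y)) = N +>\<^bsub>M\<^esub> (a \<odot>\<^bsub>M\<^esub> x)"
      using S.a_rcos_self[OF x] by (intro SUP_eq_const coset_eq) auto
    then show ?thesis by (simp add: quotient_module_def)
  qed
qed

lemma quotient_module_module:
  assumes "LinearCombinations.submodule R N M"
  shows "Module.module R (quotient_module M N)"
proof -
  interpret N: LinearCombinations.submodule R N M by fact
  interpret M: Module.module R M by (rule N.module)
  note simps = quotient_module_simps[OF assms]
  show ?thesis
  proof (rule Module.moduleI)
    show "cring R" by (rule M.R.is_cring)
    show "abelian_group (quotient_module M N)"
    proof (rule abelian_groupI)
      fix t assume "t \<in> carrier (quotient_module M N)"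
      then obtain x where x: "x \<in> carrier M" "t = N +>\<^bsub>M\<^esub> x" by (auto simp: simps)
      then show "\<exists>u\<in>carrier (quotient_module M N). u \<oplus>\<^bsub>quotient_module M N\<^esub> t = \<zero>\<^bsub>quotient_module M N\<^esub>"
        by (intro bexI[of _ "N +>\<^bsub>M\<^esub> (\<ominus>\<^bsub>M\<^esub> x)"]) (auto simp: simps M.l_neg)
    qed (auto simp: simps M.a_ac)
  qed (auto simp: simps M.smult_l_distr M.smult_r_distr M.smult_assoc1)
qed

section \<open>Linear and bilinear maps\<close>

definition bilinear ::
  "('r, 'c) ring_scheme \<Rightarrow> ('r, 'm, 'd) module_scheme \<Rightarrow> ('r, 'n, 'e) module_scheme
    \<Rightarrow> ('r, 'p, 'f) module_scheme \<Rightarrow> ('m \<Rightarrow> 'n \<Rightarrow> 'p) \<Rightarrow> bool" where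
  "bilinear R M N P \<beta> \<longleftrightarrow>
    (\<forall>x\<in>carrier M. \<beta> x \<in> LinearCombinations.module_hom R N P) \<and>
    (\<forall>y\<in>carrier N. (\<lambda>x. \<beta> x y) \<in> LinearCombinations.module_hom R M P)"

lemma module_homI:
  assumes "\<And>x. x \<in> carrier M \<Longrightarrow> f x \<in> carrier N"
    and "\<And>x y. \<lbrakk>x \<in> carrier M; y \<in> carrier M\<rbrakk> \<Longrightarrow> f (x \<oplus>\<^bsub>M\<^esub> y) = f x \<oplus>\<^bsub>N\<^esub> f y"
    and "\<And>a x. \<lbrakk>a \<in> carrier R; x \<in> carrier M\<rbrakk> \<Longrightarrow> f (a \<odot>\<^bsub>M\<^esub> x) = a \<odot>\<^bsub>N\<^esub> f x"
  shows "f \<in> LinearCombinations.module_hom R M N"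
  using assms by (auto simp: LinearCombinations.module_hom_def)

lemma module_homD:
  assumes "f \<in> LinearCombinations.module_hom R M N"
  shows "x \<in> carrier M \<Longrightarrow> f x \<in> carrier N"
    and "\<lbrakk>x \<in> carrier M; y \<in> carrier M\<rbrakk> \<Longrightarrow> f (x \<oplus>\<^bsub>M\<^esub> y) = f x \<oplus>\<^bsub>N\<^esub> f y"
    and "\<lbrakk>a \<in> carrier R; x \<in> carrier M\<rbrakk> \<Longrightarrow> f (a \<odot>\<^bsub>M\<^esub> x) = a \<odot>\<^bsub>N\<^esub> f x"
  using assms by (auto simp: LinearCombinations.module_hom_def)

lemma bilinearD:
  assumes "bilinear R M N P \<beta>"
  shows "\<lbrakk>x \<in> carrier M; y \<in> carrier N\<rbrakk> \<Longrightarrow> \<beta> x y \<in> carrier P"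
    and "\<lbrakk>x \<in> carrier M; x' \<in> carrier M; y \<in> carrier N\<rbrakk> \<Longrightarrow> \<beta> (x \<oplus>\<^bsub>M\<^esub> x') y = \<beta> x y \<oplus>\<^bsub>P\<^esub> \<beta> x' y"
    and "\<lbrakk>x \<in> carrier M; y \<in> carrier N; y' \<in> carrier N\<rbrakk> \<Longrightarrow> \<beta> x (y \<oplus>\<^bsub>N\<^esub> y') = \<beta> x y \<oplus>\<^bsub>P\<^esub> \<beta> x y'"
    and "\<lbrakk>a \<in> carrier R; x \<in> carrier M; y \<in> carrier N\<rbrakk> \<Longrightarrow> \<beta> (a \<odot>\<^bsub>M\<^esub> x) y = a \<odot>\<^bsub>P\<^esub> \<beta> x y"
    and "\<lbrakk>a \<in> carrier R; x \<in> carrier M; y \<in> carrier N\<rbrakk> \<Longrightarrow> \<beta> x (a \<odot>\<^bsub>N\<^esub> y) = a \<odot>\<^bsub>P\<^esub> \<beta> x y"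
  using assms by (auto simp: bilinear_def LinearCombinations.module_hom_def)

text \<open>Supplies the bilinear maps that define \<open>tensor_map\<close> and the inner lift of
  \<open>tensor_assoc\<close>.\<close>

lemma bilinear_comp:
  assumes "bilinear R M N P \<beta>"
    and "f \<in> LinearCombinations.module_hom R M' M" "g \<in> LinearCombinations.module_hom R N' N"
  shows "bilinear R M' N' P (\<lambda>x y. \<beta> (f x) (g y))"
  unfolding bilinear_def
  by (auto intro!: module_homI simp: bilinearD[OF assms(1)] module_homD[OF assms(2)]
      module_homD[OF assms(3)])

section \<open>Linear extension of a function on the basis of a free module\<close>

definition free_lift ::
  "('r, 'c) ring_scheme \<Rightarrow> ('r, 'p, 'd) module_scheme \<Rightarrow> ('x \<Rightarrow> 'p) \<Rightarrow> ('x \<Rightarrow> 'r) \<Rightarrow> 'p" where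
  "free_lift R P \<phi> f = (\<Oplus>\<^bsub>P\<^esub>p \<in> {p. f p \<noteq> \<zero>\<^bsub>R\<^esub>}. f p \<odot>\<^bsub>P\<^esub> \<phi> p)"

context Module.module
begin

text \<open>The index set in \<open>free_lift\<close> changes with f. Terms outside the support
  vanish, so any larger finite S may replace it, and sums for different f become comparable; S stays
  inside \<open>X\<close>, where \<phi> takes values in \<open>M\<close>.\<close>

lemma free_lift_eq_finsum:
  assumes \<phi>: "\<phi> \<in> X \<rightarrow> carrier M" and f: "f \<in> carrier (free_module R X)"
    and S: "finite S" "{x. f x \<noteq> \<zero>} \<subseteq> S" "S \<subseteq> X"
  shows "free_lift R M \<phi> f = (\<Oplus>\<^bsub>M\<^esub>x \<in> S. f x \<odot>\<^bsub>M\<^esub> \<phi> x)"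
  unfolding free_lift_def
  by (rule M.add.finprod_mono_neutral_cong_left)
    (use assms free_module_carrierD(1)[OF f] in \<open>auto simp: Pi_iff subset_iff\<close>)

lemma free_lift_closed:
  assumes \<phi>: "\<phi> \<in> X \<rightarrow> carrier M" and f: "f \<in> carrier (free_module R X)"
  shows "free_lift R M \<phi> f \<in> carrier M"
  unfolding free_lift_def
  by (rule M.finsum_closed) (use assms free_module_carrierD[OF f] in \<open>auto simp: Pi_iff\<close>)

lemma free_lift_hom:
  assumes \<phi>: "\<phi> \<in> X \<rightarrow> carrier M"
  shows "free_lift R M \<phi> \<in> LinearCombinations.module_hom R (free_module R X) M"
proof (rule module_homI)
  fix f g assume f: "f \<in> carrier (free_module R X)" and g: "g \<in> carrier (free_module R X)"
  note fg = free_module_closed(1)[OF f g]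
  \<comment> \<open>One index set for f, g and their sum, whose support may be smaller through
    cancellation.\<close>
  define S where "S = {x. f x \<noteq> \<zero>} \<union> {x. g x \<noteq> \<zero>}"
  have S: "finite S" "S \<subseteq> X"
    using free_module_carrierD[OF f] free_module_carrierD[OF g] by (auto simp: S_def)
  have "{x. (f \<oplus>\<^bsub>free_module R X\<^esub> g) x \<noteq> \<zero>} \<subseteq> S"
    by (auto simp: S_def free_module_simps)
  then have "free_lift R M \<phi> (f \<oplus>\<^bsub>free_module R X\<^esub> g)
      = (\<Oplus>\<^bsub>M\<^esub>x \<in> S. (f \<oplus>\<^bsub>free_module R X\<^esub> g) x \<odot>\<^bsub>M\<^esub> \<phi> x)"
    by (intro free_lift_eq_finsum[OF \<phi> fg] S)
  also have "\<dots> = (\<Oplus>\<^bsub>M\<^esub>x \<in> S. f x \<odot>\<^bsub>M\<^esub> \<phi> x \<oplus>\<^bsub>M\<^esub> g x \<odot>\<^bsub>M\<^esub> \<phi> x)"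
    by (rule M.finsum_cong')
      (use S \<phi> free_module_carrierD(1)[OF f] free_module_carrierD(1)[OF g] in
        \<open>auto simp: free_module_simps smult_l_distr Pi_iff subset_iff\<close>)
  also have "\<dots> = (\<Oplus>\<^bsub>M\<^esub>x \<in> S. f x \<odot>\<^bsub>M\<^esub> \<phi> x) \<oplus>\<^bsub>M\<^esub> (\<Oplus>\<^bsub>M\<^esub>x \<in> S. g x \<odot>\<^bsub>M\<^esub> \<phi> x)"
    by (rule M.finsum_addf)
      (use S \<phi> free_module_carrierD(1)[OF f] free_module_carrierD(1)[OF g] in
        \<open>auto simp: Pi_iff subset_iff\<close>)
  also have "\<dots> = free_lift R M \<phi> f \<oplus>\<^bsub>M\<^esub> free_lift R M \<phi> g"
    using S by (subst (1 2) free_lift_eq_finsum[OF \<phi>, of _ S]) (auto simp: f g S_def)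
  finally show "free_lift R M \<phi> (f \<oplus>\<^bsub>free_module R X\<^esub> g)
      = free_lift R M \<phi> f \<oplus>\<^bsub>M\<^esub> free_lift R M \<phi> g" .
next
  fix a f assume a: "a \<in> carrier R" and f: "f \<in> carrier (free_module R X)"
  note fD = free_module_carrierD[OF f]
  \<comment> \<open>Scaling may shrink the support (zero scalar or zero divisors), so the sum is
    kept over the support of f.\<close>
  have "free_lift R M \<phi> (a \<odot>\<^bsub>free_module R X\<^esub> f)
      = (\<Oplus>\<^bsub>M\<^esub>x \<in> {x. f x \<noteq> \<zero>}. (a \<odot>\<^bsub>free_module R X\<^esub> f) x \<odot>\<^bsub>M\<^esub> \<phi> x)"
    using a by (intro free_lift_eq_finsum[OF \<phi> free_module_closed(2)[OF f a]] fD)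
      (auto simp: free_module_simps)
  also have "\<dots> = (\<Oplus>\<^bsub>M\<^esub>x \<in> {x. f x \<noteq> \<zero>}. a \<odot>\<^bsub>M\<^esub> (f x \<odot>\<^bsub>M\<^esub> \<phi> x))"
    by (rule M.finsum_cong')
      (use a \<phi> fD in \<open>auto simp: free_module_simps smult_assoc1 Pi_iff subset_iff\<close>)
  also have "\<dots> = a \<odot>\<^bsub>M\<^esub> free_lift R M \<phi> f"
    unfolding free_lift_def
    by (rule finsum_smult[symmetric]) (use a \<phi> fD in \<open>auto simp: Pi_iff subset_iff\<close>)
  finally show "free_lift R M \<phi> (a \<odot>\<^bsub>free_module R X\<^esub> f) = a \<odot>\<^bsub>M\<^esub> free_lift R M \<phi> f" .
qed (rule free_lift_closed[OF \<phi>])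

lemma free_lift_free_gen:
  assumes \<phi>: "\<phi> \<in> X \<rightarrow> carrier M" and x: "x \<in> X"
  shows "free_lift R M \<phi> (free_gen R x) = \<phi> x"
proof -
  \<comment> \<open>The index set is \<open>{x}\<close> and not the support, which is empty when
    \<open>R\<close> is the trivial ring.\<close>
  have "free_lift R M \<phi> (free_gen R x) = (\<Oplus>\<^bsub>M\<^esub>y \<in> {x}. free_gen R x y \<odot>\<^bsub>M\<^esub> \<phi> y)"
    using x by (intro free_lift_eq_finsum[OF \<phi> free_gen_closed]) (auto simp: free_gen_def)
  also have "\<dots> = \<phi> x"
    using \<phi> x by (auto simp: free_gen_def Pi_iff)
  finally show ?thesis .
qed

text \<open>Here f is fixed and the function on the basis varies linearly with z. The support does
  not depend on z, so linearity passes through the finite sum term by term.\<close>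

lemma free_lift_pointwise_hom:
  assumes \<phi>: "\<And>x. x \<in> X \<Longrightarrow> (\<lambda>z. \<phi> z x) \<in> LinearCombinations.module_hom R L M"
    and f: "f \<in> carrier (free_module R X)"
  shows "(\<lambda>z. free_lift R M (\<phi> z) f) \<in> LinearCombinations.module_hom R L M"
proof (rule module_homI)
  note fD = free_module_carrierD[OF f]
  have X: "x \<in> X" if "f x \<noteq> \<zero>" for x using that fD(3) by auto
  have cl: "\<phi> z x \<in> carrier M" if "z \<in> carrier L" "f x \<noteq> \<zero>" for z x
    using module_homD(1)[OF \<phi>[OF X]] that by blast
  show "free_lift R M (\<phi> z) f \<in> carrier M" if "z \<in> carrier L" for z
    using that by (intro free_lift_closed[OF _ f]) (auto dest: module_homD(1)[OF \<phi>])
  show "free_lift R M (\<phi> (z \<oplus>\<^bsub>L\<^esub> z')) f = free_lift R M (\<phi> z) f \<oplus>\<^bsub>M\<^esub> free_lift R M (\<phi> z') f"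
    if z: "z \<in> carrier L" "z' \<in> carrier L" for z z'
    unfolding free_lift_def
    by (subst M.finsum_addf[symmetric], (use z fD cl in \<open>auto intro!: M.finsum_cong'\<close>)[2],
        rule M.finsum_cong')
      (use z fD cl X in \<open>auto simp: module_homD(2)[OF \<phi>] smult_r_distr\<close>)
  \<comment> \<open>The scalar a has to move past the coefficient f x, which uses that
    \<open>R\<close> is commutative.\<close>
  show "free_lift R M (\<phi> (a \<odot>\<^bsub>L\<^esub> z)) f = a \<odot>\<^bsub>M\<^esub> free_lift R M (\<phi> z) f"
    if az: "a \<in> carrier R" "z \<in> carrier L" for a z
    unfolding free_lift_def
    by (subst finsum_smult, (use az fD cl in auto)[2], rule M.finsum_cong')
      (use az fD cl X in \<open>auto simp: module_homD(3)[OF \<phi>] smult_assoc1[symmetric] m_comm\<close>)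
qed

end

lemma module_hom_id: "id \<in> LinearCombinations.module_hom R M M"
  by (rule module_homI) auto

lemma module_hom_comp:
  assumes "f \<in> LinearCombinations.module_hom R L M" "g \<in> LinearCombinations.module_hom R M N"
  shows "(\<lambda>x. g (f x)) \<in> LinearCombinations.module_hom R L N"
  by (rule module_homI) (simp_all add: module_homD[OF assms(1)] module_homD[OF assms(2)])

section \<open>The tensor product and its universal property\<close>

locale module_pair = M: Module.module R M + N: Module.module R N for R M N
begin

abbreviation F where "F \<equiv> free_module R (carrier M \<times> carrier N)"
abbreviation T where "T \<equiv> tensor_product R M N"

lemma free_module_F: "Module.module R F"
  by (rule M.free_module_module)

lemma relators_closed: "bilinearity_relators R M N \<subseteq> carrier F"
proof -
  interpret F: Module.module R F by (rule free_module_F)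
  show ?thesis
    unfolding bilinearity_relators_def Let_def
    by (auto intro!: F.M.minus_closed F.M.add.m_closed F.smult_closed M.free_gen_closed)
qed

lemma tensor_relations_submodule:
  "LinearCombinations.submodule R (tensor_relations R M N) F"
proof -
  interpret F: Module.module R F by (rule free_module_F)
  show ?thesis
    unfolding tensor_relations_def by (rule F.span_is_submodule[OF relators_closed])
qed

lemma relators_subset: "bilinearity_relators R M N \<subseteq> tensor_relations R M N"
proof -
  interpret F: Module.module R F by (rule free_module_F)
  show ?thesis
    unfolding tensor_relations_def by (rule F.in_own_span[OF relators_closed])
qed

lemma tensor_product_module: "Module.module R T"
  unfolding tensor_product_def by (rule quotient_module_module[OF tensor_relations_submodule])

lemmas tensor_product_simps =
  quotient_module_simps[OF tensor_relations_submodule, folded tensor_product_def]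

text \<open>Relators are differences, so this turns membership of a relator in the relations into an
  equation between classes.\<close>

lemma coset_eqI:
  assumes "f \<ominus>\<^bsub>F\<^esub> g \<in> tensor_relations R M N" "f \<in> carrier F" "g \<in> carrier F"
  shows "tensor_relations R M N +>\<^bsub>F\<^esub> f = tensor_relations R M N +>\<^bsub>F\<^esub> g"
proof -
  interpret F: abelian_subgroup "tensor_relations R M N" F
    by (rule submodule_abelian_subgroup[OF tensor_relations_submodule])
  show ?thesis
    using assms F.a_rcos_module_rev[of g f] F.a_repr_independence'[of f g]
    by (simp add: a_minus_def)
qed

text \<open>Each of the four laws is the vanishing of one of the four families of relators modulo
  the relations.\<close>

lemma pure_tensor_bilinear: "bilinear R M N T (pure_tensor R M N)"
proof -
  interpret F: Module.module R F by (rule free_module_F)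
  let ?g = "\<lambda>x y. free_gen R (x, y)"
  note rel = subsetD[OF relators_subset, unfolded bilinearity_relators_def Let_def]
  have g: "?g x y \<in> carrier F" if "x \<in> carrier M" "y \<in> carrier N" for x y
    using that by (auto intro: M.free_gen_closed)
  show ?thesis
    unfolding bilinear_def
  proof (intro conjI ballI module_homI)
    show "pure_tensor R M N x y \<in> carrier T" if "x \<in> carrier M" "y \<in> carrier N" for x y
      using g[OF that] by (auto simp: pure_tensor_def tensor_product_simps)
    \<comment> \<open>The closure goal arises twice, once for linearity in each argument.\<close>
    then show "pure_tensor R M N x y \<in> carrier T" if "x \<in> carrier M" "y \<in> carrier N" for x y
      using that by blast
    fix x y assume xy: "x \<in> carrier M" "y \<in> carrier N"
    show "pure_tensor R M N x (y \<oplus>\<^bsub>N\<^esub> y') = pure_tensor R M N x y \<oplus>\<^bsub>T\<^esub> pure_tensor R M N x y'"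
      if y': "y' \<in> carrier N" for y'
      unfolding pure_tensor_def using xy y'
      by (subst tensor_product_simps, (auto intro: g)[2], intro coset_eqI rel) (auto intro: g)
    show "pure_tensor R M N (x \<oplus>\<^bsub>M\<^esub> x') y = pure_tensor R M N x y \<oplus>\<^bsub>T\<^esub> pure_tensor R M N x' y"
      if x': "x' \<in> carrier M" for x'
      unfolding pure_tensor_def using xy x'
      by (subst tensor_product_simps, (auto intro: g)[2], intro coset_eqI rel) (auto intro: g)
    fix a assume a: "a \<in> carrier R"
    show "pure_tensor R M N x (a \<odot>\<^bsub>N\<^esub> y) = a \<odot>\<^bsub>T\<^esub> pure_tensor R M N x y"
      unfolding pure_tensor_def using xy a
      by (subst tensor_product_simps, (auto intro: g)[2], intro coset_eqI rel) (auto intro: g)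
    show "pure_tensor R M N (a \<odot>\<^bsub>M\<^esub> x) y = a \<odot>\<^bsub>T\<^esub> pure_tensor R M N x y"
      unfolding pure_tensor_def using xy a
      by (subst tensor_product_simps, (auto intro: g)[2], intro coset_eqI rel) (auto intro: g)
  qed
qed

lemmas pure_tensor_closed = bilinearD(1)[OF pure_tensor_bilinear]

text \<open>The kernel of the linear extension of \<beta> is a submodule. Bilinearity of \<beta>
  puts every relator into it, hence also their span.\<close>

lemma tensor_relations_vanish:
  assumes P: "Module.module R P" and \<beta>: "bilinear R M N P \<beta>"
    and r: "r \<in> tensor_relations R M N"
  shows "free_lift R P (\<lambda>p. \<beta> (fst p) (snd p)) r = \<zero>\<^bsub>P\<^esub>"
proof -
  interpret F: Module.module R F by (rule free_module_F)
  interpret P: Module.module R P by fact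
  let ?l = "free_lift R P (\<lambda>p. \<beta> (fst p) (snd p))"
  have \<phi>: "(\<lambda>p. \<beta> (fst p) (snd p)) \<in> carrier M \<times> carrier N \<rightarrow> carrier P"
    by (auto simp: bilinearD[OF \<beta>])
  interpret l: mod_hom R F P ?l
    by unfold_locales (rule P.free_lift_hom[OF \<phi>])
  have l_gen: "?l (free_gen R (x, y)) = \<beta> x y" if "x \<in> carrier M" "y \<in> carrier N" for x y
    using P.free_lift_free_gen[OF \<phi>, of "(x, y)"] that by simp
  have g: "free_gen R (x, y) \<in> carrier F" if "x \<in> carrier M" "y \<in> carrier N" for x y
    using that by (auto intro: M.free_gen_closed)
  have "bilinearity_relators R M N \<subseteq> l.ker"
    using relators_closed unfolding bilinearity_relators_def Let_def l.ker_def
    by (auto simp: l_gen g bilinearD[OF \<beta>] l.f_minus)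
  then have "tensor_relations R M N \<subseteq> l.ker"
    unfolding tensor_relations_def by (rule F.span_is_subset[OF _ l.ker_is_submodule])
  with r show ?thesis by (auto simp: l.ker_def)
qed

text \<open>This justifies \<open>the_elem\<close> in \<open>tensor_lift\<close>: two
  representatives of a class differ by a relation, which the extension of \<beta> kills.\<close>

lemma tensor_lift_coset:
  assumes P: "Module.module R P" and \<beta>: "bilinear R M N P \<beta>" and f: "f \<in> carrier F"
  shows "tensor_lift R P \<beta> (tensor_relations R M N +>\<^bsub>F\<^esub> f)
    = free_lift R P (\<lambda>p. \<beta> (fst p) (snd p)) f"
proof -
  interpret P: Module.module R P by fact
  interpret S: LinearCombinations.submodule R "tensor_relations R M N" F
    by (rule tensor_relations_submodule)
  interpret F: abelian_subgroup "tensor_relations R M N" F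
    by (rule submodule_abelian_subgroup[OF tensor_relations_submodule])
  let ?l = "free_lift R P (\<lambda>p. \<beta> (fst p) (snd p))"
  have \<phi>: "(\<lambda>p. \<beta> (fst p) (snd p)) \<in> carrier M \<times> carrier N \<rightarrow> carrier P"
    by (auto simp: bilinearD[OF \<beta>])
  note hom = P.free_lift_hom[OF \<phi>]
  have "?l g = ?l f" if "g \<in> tensor_relations R M N +>\<^bsub>F\<^esub> f" for g
  proof -
    from that obtain r where r: "r \<in> tensor_relations R M N" "g = r \<oplus>\<^bsub>F\<^esub> f"
      by (auto simp: a_r_coset_def')
    then show ?thesis
      using f S.subset tensor_relations_vanish[OF P \<beta> r(1)] module_homD(1,2)[OF hom]
      by (auto simp: subset_iff)
  qed
  \<comment> \<open>The image is exactly a singleton because the coset contains f.\<close>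
  then have "?l ` (tensor_relations R M N +>\<^bsub>F\<^esub> f) = {?l f}"
    using F.a_rcos_self[OF f] by blast
  then show ?thesis
    by (simp add: tensor_lift_def free_lift_def)
qed

lemma tensor_lift_hom:
  assumes P: "Module.module R P" and \<beta>: "bilinear R M N P \<beta>"
  shows "tensor_lift R P \<beta> \<in> LinearCombinations.module_hom R T P"
proof -
  interpret F: Module.module R F by (rule free_module_F)
  interpret P: Module.module R P by fact
  have \<phi>: "(\<lambda>p. \<beta> (fst p) (snd p)) \<in> carrier M \<times> carrier N \<rightarrow> carrier P"
    by (auto simp: bilinearD[OF \<beta>])
  show ?thesis
    by (rule module_homI)
      (auto simp: tensor_product_simps tensor_lift_coset[OF P \<beta>]
        module_homD[OF P.free_lift_hom[OF \<phi>]])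
qed

lemma tensor_lift_pure_tensor:
  assumes P: "Module.module R P" and \<beta>: "bilinear R M N P \<beta>"
    and xy: "x \<in> carrier M" "y \<in> carrier N"
  shows "tensor_lift R P \<beta> (pure_tensor R M N x y) = \<beta> x y"
proof -
  interpret P: Module.module R P by fact
  have \<phi>: "(\<lambda>p. \<beta> (fst p) (snd p)) \<in> carrier M \<times> carrier N \<rightarrow> carrier P"
    by (auto simp: bilinearD[OF \<beta>])
  have p: "(x, y) \<in> carrier M \<times> carrier N" using xy by simp
  show ?thesis
    unfolding pure_tensor_def
    using tensor_lift_coset[OF P \<beta> M.free_gen_closed[OF p]] P.free_lift_free_gen[OF \<phi> p] by simp
qed

text \<open>A representative of t can be chosen once for all z, since t is fixed; the claim then
  becomes the termwise statement about \<open>free_lift\<close>. It yields linearity of the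
  associator's outer map in its last argument.\<close>

lemma tensor_lift_pointwise_hom:
  assumes P: "Module.module R P" and L: "Module.module R L"
    and \<beta>: "\<And>z. z \<in> carrier L \<Longrightarrow> bilinear R M N P (\<beta> z)"
    and hom: "\<And>x y. \<lbrakk>x \<in> carrier M; y \<in> carrier N\<rbrakk> \<Longrightarrow>
      (\<lambda>z. \<beta> z x y) \<in> LinearCombinations.module_hom R L P"
    and t: "t \<in> carrier T"
  shows "(\<lambda>z. tensor_lift R P (\<beta> z) t) \<in> LinearCombinations.module_hom R L P"
proof -
  interpret P: Module.module R P by fact
  interpret L: Module.module R L by fact
  from t obtain f where f: "f \<in> carrier F" "t = tensor_relations R M N +>\<^bsub>F\<^esub> f"
    by (auto simp: tensor_product_simps)
  have "(\<lambda>z. free_lift R P (\<lambda>p. \<beta> z (fst p) (snd p)) f) \<in> LinearCombinations.module_hom R L P"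
    by (rule P.free_lift_pointwise_hom[OF _ f(1)]) (auto intro: hom)
  \<comment> \<open>Bilinearity of \<open>\<beta> z\<close> is known only for z in \<open>L\<close>,
    so the definition of homomorphism is unfolded to make that hypothesis available to the
    rewriting.\<close>
  then show ?thesis
    by (auto simp: f(2) tensor_lift_coset[OF P \<beta> f(1)] LinearCombinations.module_hom_def)
qed

end

section \<open>Tensor maps and the associator on pure tensors\<close>

lemma tensor_map_pure_tensor:
  assumes M: "Module.module R M" and N: "Module.module R N"
    and M': "Module.module R M'" and N': "Module.module R N'"
    and f: "f \<in> LinearCombinations.module_hom R M M'"
    and g: "g \<in> LinearCombinations.module_hom R N N'"
    and xy: "x \<in> carrier M" "y \<in> carrier N"
  shows "tensor_map R M' N' f g (pure_tensor R M N x y) = pure_tensor R M' N' (f x) (g y)"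
proof -
  interpret MN: module_pair R M N using M N by (rule module_pair.intro)
  interpret MN': module_pair R M' N' using M' N' by (rule module_pair.intro)
  show ?thesis
    unfolding tensor_map_def
    by (rule MN.tensor_lift_pure_tensor[OF MN'.tensor_product_module
          bilinear_comp[OF MN'.pure_tensor_bilinear f g] xy])
qed

text \<open>The associator is a lift whose bilinear map is itself a lift. The outer lift may be
  evaluated only once the inner one is known to be bilinear in t and z.\<close>

lemma tensor_assoc_pure_tensor:
  assumes L: "Module.module R L" and M: "Module.module R M" and N: "Module.module R N"
    and xyz: "x \<in> carrier L" "y \<in> carrier M" "z \<in> carrier N"
  shows "tensor_assoc R L M N (pure_tensor R (tensor_product R L M) N (pure_tensor R L M x y) z)
    = pure_tensor R L (tensor_product R M N) x (pure_tensor R M N y z)"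
proof -
  let ?LM = "tensor_product R L M" and ?MN = "tensor_product R M N"
  let ?P = "tensor_product R L ?MN"
  \<comment> \<open>The last factor comes first as a parameter: for each z this is a bilinear map in
    x and y.\<close>
  let ?\<gamma> = "\<lambda>z x y. pure_tensor R L ?MN x (pure_tensor R M N y z)"
  interpret LM: module_pair R L M using L M by (rule module_pair.intro)
  interpret MN: module_pair R M N using M N by (rule module_pair.intro)
  interpret LMN: module_pair R L ?MN using L MN.tensor_product_module by (rule module_pair.intro)
  interpret LM_N: module_pair R ?LM N using LM.tensor_product_module N by (rule module_pair.intro)
  note P = LMN.tensor_product_module
  have \<gamma>: "bilinear R L M ?P (?\<gamma> z)" if "z \<in> carrier N" for z
    using bilinear_comp[OF LMN.pure_tensor_bilinear module_hom_id, of "\<lambda>y. pure_tensor R M N y z" M]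
      MN.pure_tensor_bilinear that by (auto simp: bilinear_def)
  have \<gamma>_hom: "(\<lambda>z. ?\<gamma> z x y) \<in> LinearCombinations.module_hom R N ?P"
    if "x \<in> carrier L" "y \<in> carrier M" for x y
    using module_hom_comp[of "pure_tensor R M N y" R N ?MN "pure_tensor R L ?MN x" ?P]
      MN.pure_tensor_bilinear LMN.pure_tensor_bilinear that by (auto simp: bilinear_def)
  \<comment> \<open>Linear in t because it is a lift, and linear in z because the lifted family is
    linear in z.\<close>
  have "bilinear R ?LM N ?P (\<lambda>t z. tensor_lift R ?P (?\<gamma> z) t)"
    unfolding bilinear_def
    by (intro conjI ballI LM.tensor_lift_pointwise_hom LM.tensor_lift_hom P N \<gamma> \<gamma>_hom)
  from LM_N.tensor_lift_pure_tensor[OF P this LM.pure_tensor_closed[OF xyz(1,2)] xyz(3)]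
  show ?thesis
    using LM.tensor_lift_pure_tensor[OF P \<gamma>[OF xyz(3)] xyz(1,2)]
    by (simp add: tensor_assoc_def Let_def)
qed

section \<open>The bialgebra structure on an arbitrary unital algebra\<close>

theorem (in assoc_algebra) infinitesimal_unitary_bialgebra_tensor_one:
  assumes l: "l \<in> carrier R"
  shows "infinitesimal_unitary_bialgebra R A l (\<lambda>x. pure_tensor R A A x ((\<ominus>\<^bsub>R\<^esub> l) \<odot> \<one>))"
proof -
  let ?T = "tensor_product R A A" and ?e = "(\<ominus>\<^bsub>R\<^esub> l) \<odot> \<one>"
  let ?\<Delta> = "\<lambda>x. pure_tensor R A A x ?e"
  have A: "Module.module R A" by (rule module_axioms)
  interpret AA: module_pair R A A using A A by (rule module_pair.intro)
  interpret T: Module.module R ?T by (rule AA.tensor_product_module)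
  have e: "?e \<in> carrier A" using l by simp
  have \<Delta>: "?\<Delta> \<in> LinearCombinations.module_hom R A ?T"
    using AA.pure_tensor_bilinear e by (auto simp: bilinear_def)
  show ?thesis
  proof unfold_locales
    show "l \<in> carrier R" by (rule l)
    show "?\<Delta> \<in> LinearCombinations.module_hom R A ?T" by (rule \<Delta>)
    fix x assume x: "x \<in> carrier A"
    \<comment> \<open>On the left, applying \<open>?\<Delta>\<close> to the first factor gives (x
      \<otimes> e) \<otimes> e, which the associator rebrackets; on the right,
      \<open>?\<Delta>\<close> is evaluated at e itself.\<close>
    show "tensor_assoc R A A A (tensor_map R ?T A ?\<Delta> id (?\<Delta> x)) = tensor_map R A ?T id ?\<Delta> (?\<Delta> x)"
      using x e
      by (simp add: tensor_map_pure_tensor[OF A A T.module_axioms A \<Delta> module_hom_id]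
          tensor_map_pure_tensor[OF A A A T.module_axioms module_hom_id \<Delta>]
          tensor_assoc_pure_tensor[OF A A A])
    fix y assume y: "y \<in> carrier A"
    have "tensor_left_action R A x (?\<Delta> y) = ?\<Delta> (x \<otimes> y)"
      unfolding tensor_left_action_def using x y e
      by (subst tensor_map_pure_tensor[OF A A A A _ module_hom_id])
        (auto intro!: module_homI simp: r_distr smult_mult_right)
    moreover have "tensor_right_action R A (?\<Delta> x) y = pure_tensor R A A x (?e \<otimes> y)"
      unfolding tensor_right_action_def using x y e
      by (subst tensor_map_pure_tensor[OF A A A A module_hom_id])
        (auto intro!: module_homI simp: l_distr smult_mult_left)
    \<comment> \<open>The product of e and y is the multiple of y by the negative of l; bilinearity
      moves the scalar out of the tensor.\<close>
    moreover have "pure_tensor R A A x (?e \<otimes> y) = \<ominus>\<^bsub>?T\<^esub> (l \<odot>\<^bsub>?T\<^esub> pure_tensor R A A x y)"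
      using x y l AA.pure_tensor_closed[OF x y]
      by (simp add: smult_mult_left bilinearD[OF AA.pure_tensor_bilinear] T.smult_l_minus)
    ultimately show "?\<Delta> (x \<otimes> y)
        = tensor_left_action R A x (?\<Delta> y) \<oplus>\<^bsub>?T\<^esub> tensor_right_action R A (?\<Delta> x) y
          \<oplus>\<^bsub>?T\<^esub> l \<odot>\<^bsub>?T\<^esub> pure_tensor R A A x y"
      using x y l e AA.pure_tensor_closed
      by (simp add: T.M.a_assoc T.M.l_neg)
  qed
qed

section \<open>The algebra of square matrices\<close>

lemma assoc_algebra_module_mat:
  "assoc_algebra class_ring (module_mat TYPE('k :: comm_ring_1) n n)"
proof -
  \<comment> \<open>The record \<open>module_mat\<close> carries the matrix product and the identity
    matrix in its ring fields, so the same record serves as ring and as module.\<close>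
  have "ring (module_mat TYPE('k) n n)"
    by (rule ringI) (use abelian_group_mat[of n n] in
        \<open>auto simp: module_mat_simps add_mult_distrib_mat mult_add_distrib_mat assoc_mult_mat
          intro!: monoidI\<close>)
  moreover have "Module.module class_ring (module_mat TYPE('k) n n)"
    by (rule Module.moduleI[OF class_cring.is_cring abelian_group_mat])
      (auto simp: module_mat_simps add_smult_distrib_right_mat add_smult_distrib_left_mat)
  ultimately show ?thesis
    by (auto intro!: assoc_algebra.intro assoc_algebra_axioms.intro simp: module_mat_simps
        mult_smult_assoc_mat mult_smult_distrib)
qed

theorem theorem2p12:
  fixes n :: nat and l :: "'k :: comm_ring_1"
  assumes "n \<ge> 1" and "l \<noteq> 0"
  defines "A \<equiv> module_mat TYPE('k) n n"
  shows "infinitesimal_unitary_bialgebra class_ring A l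
    (\<lambda>M. pure_tensor class_ring A A M ((- l) \<cdot>\<^sub>m 1\<^sub>m n))"
proof -
  interpret assoc_algebra class_ring A
    unfolding A_def by (rule assoc_algebra_module_mat)
  show ?thesis
    \<comment> \<open>Negation in \<open>class_ring\<close> is that of the type and the unit of
      \<open>A\<close> is \<open>1\<^sub>m n\<close>, so the general e becomes
      \<open>(- l) \<cdot>\<^sub>m 1\<^sub>m n\<close>.\<close>
    using infinitesimal_unitary_bialgebra_tensor_one[of l]
    by (simp add: A_def module_mat_simps class_ring_simps)
qed

end
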